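(* Let $K\subset\mathbb{R}^3$ be a centrally symmetric convex body (i.e. a compact convex set with $K=-K$) such that $\mathrm{r}_2(K)>0$. Then \[ \frac{\mathrm{R}_2(K)}{\mathrm{r}_2(K)}\leq \frac{2\sqrt{2}}{\sqrt{3}}. \]
   Context: A convex body is a compact convex subset of $\mathbb{R}^n$. For $1\le i\le n$, let $\mathcal{L}^n_i$ be the set of $i$-dimensional linear subspaces of $\mathbb{R}^n$, $K|L$ the orthogonal projection of $K$ onto $L$, $L^\perp$ the orthogonal complement. For a set $C$ contained in an affine subspace $A$, $\mathrm{R}(C;A)$ and $\mathrm{r}(C;A)$ denote the Euclidean circumradius and inradius of $C$ measured within $A$. Define $\mathrm{R}_i(K)=\min_{L\in\mathcal{L}^n_i}\mathrm{R}(K|L;L)$ (the smallest radius of a solid cylinder with $i$-dimensional spherical cross-section containing $K$) and $\mathrm{r}_i(K)=\max_{L\in\mathcal{L}^n_i}\max_{x\in L^\perp}\mathrm{r}(K\cap(x+L);x+L)$ (the largest radius of an $i$-dimensional Euclidean disc contained in $K$). *)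

theory Defs
  imports "HOL-Analysis.Analysis"
begin

definition oproj :: "'a::euclidean_space set \<Rightarrow> 'a \<Rightarrow> 'a" where
  "oproj L x = (THE p. p \<in> L \<and> (\<forall>y\<in>L. orthogonal (x - p) y))"

definition circumradius_in :: "'a::euclidean_space set \<Rightarrow> 'a set \<Rightarrow> real" where
  "circumradius_in C A = Inf {r. \<exists>c\<in>A. C \<subseteq> cball c r}"

definition inradius_in :: "'a::euclidean_space set \<Rightarrow> 'a set \<Rightarrow> real" where
  "inradius_in C A = Sup {r. 0 \<le> r \<and> (\<exists>c\<in>A. cball c r \<inter> A \<subseteq> C)}"

definition lin_subspaces :: "nat \<Rightarrow> 'a::euclidean_space set set" where
  "lin_subspaces i = {L. subspace L \<and> dim L = i}"

definition outer_radius :: "nat \<Rightarrow> 'a::euclidean_space set \<Rightarrow> real" where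
  "outer_radius i K = Inf {circumradius_in (oproj L ` K) L | L. L \<in> lin_subspaces i}"

text \<open>Maximum over L and x in the orthogonal complement of L; sections with
  empty intersection are excluded (their inradius is not meaningful).\<close>
definition inner_radius :: "nat \<Rightarrow> 'a::euclidean_space set \<Rightarrow> real" where
  "inner_radius i K = Sup {inradius_in (K \<inter> ((+) x ` L)) ((+) x ` L) | L x.
      L \<in> lin_subspaces i \<and> x \<in> orthogonal_comp L \<and> K \<inter> ((+) x ` L) \<noteq> {}}"

end

theory Submission
  imports Defs
begin

text \<open>
  Let \<open>x\<close> be a point of \<open>K\<close> farthest from the origin, and among the oblique projections onto the
  plane \<open>H = x\<^sup>\<bottom>\<close> choose one whose image of \<open>K\<close> has the least circumradius \<open>\<rho>\<close>. Orthogonal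
  projection along the same direction is shorter, so \<open>R\<^sub>2 \<le> \<rho>\<close>. The first-order optimality condition
  and Caratheodory's theorem in \<open>H\<close> produce at most three points of \<open>K\<close> on the minimal cylinder;
  combining two of them into a point of \<open>K \<inter> H\<close> shows that the longest \<open>a \<in> K \<inter> H\<close> satisfies
  \<open>3 \<rho>\<^sup>2 \<le> 4 |a|\<^sup>2\<close>. Since \<open>a \<bottom> x\<close> and \<open>|a| \<le> |x|\<close>, the rhombus with vertices \<open>\<plusminus>x, \<plusminus>a\<close> contains a disc
  of radius \<open>|a| / \<surd>2\<close>, whence \<open>r\<^sub>2 \<ge> |a| / \<surd>2\<close>.
\<close>

section \<open>Optimal oblique projections and the length of the central slice\<close>

text \<open>The map \<open>z - (e \<bullet> z) *\<^sub>R v\<close> is the projection along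
  \<open>v\<close> onto the hyperplane orthogonal to \<open>e\<close>. A minimiser exists because
  the image of the single point \<open>x\<close>, which lies off that hyperplane, already controls
  the size of \<open>v\<close>.\<close>

lemma exists_optimal_oblique_projection:
  fixes K :: "'a::euclidean_space set"
  assumes "compact K" "x \<in> K" "e \<bullet> x \<noteq> 0"
  obtains v \<rho> where "e \<bullet> v = 1" "\<And>z. z \<in> K \<Longrightarrow> norm (z - (e \<bullet> z) *\<^sub>R v) \<le> \<rho>"
    "\<And>w t. e \<bullet> w = 1 \<Longrightarrow> (\<And>z. z \<in> K \<Longrightarrow> norm (z - (e \<bullet> z) *\<^sub>R w) \<le> t) \<Longrightarrow> \<rho> \<le> t"
proof -
  define v0 where "v0 = x /\<^sub>R (e \<bullet> x)"
  have v0: "e \<bullet> v0 = 1" using assms by (simp add: v0_def)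
  have "compact ((\<lambda>z. z - (e \<bullet> z) *\<^sub>R v0) ` K)"
    by (intro compact_continuous_image continuous_intros assms)
  then obtain B where B: "\<And>z. z \<in> K \<Longrightarrow> norm (z - (e \<bullet> z) *\<^sub>R v0) \<le> B"
    using compact_imp_bounded bounded_iff[of "(\<lambda>z. z - (e \<bullet> z) *\<^sub>R v0) ` K"] by auto
  \<comment> \<open>Pairs of a direction and an admissible radius. Capping the radius at the trial
    value \<open>B\<close> makes the set bounded and loses nothing, since a competitor with larger
    radius is worse anyway.\<close>
  define T where "T = {p. e \<bullet> fst p = 1} \<inter> {p. snd p \<le> B} \<inter>
      (\<Inter>z\<in>K. {p. norm (z - (e \<bullet> z) *\<^sub>R fst p) \<le> snd p})"
  have "closed T"
    unfolding T_def
    by (intro closed_Int closed_INT ballI closed_Collect_eq closed_Collect_le continuous_intros)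
  moreover have "bounded T"
  proof -
    have "p \<in> cball 0 ((B + norm x) / \<bar>e \<bullet> x\<bar>) \<times> {0..B}" if "p \<in> T" for p
    proof -
      have p: "norm (x - (e \<bullet> x) *\<^sub>R fst p) \<le> snd p" "snd p \<le> B"
        using that assms by (auto simp: T_def)
      have "\<bar>e \<bullet> x\<bar> * norm (fst p) \<le> B + norm x"
        using p norm_triangle_ineq2[of "(e \<bullet> x) *\<^sub>R fst p" x]
        by (simp add: norm_minus_commute)
      then have "norm (fst p) \<le> (B + norm x) / \<bar>e \<bullet> x\<bar>"
        using assms by (simp add: field_simps)
      moreover have "0 \<le> snd p" using p(1) norm_ge_zero order_trans by blast
      ultimately show ?thesis using p by (cases p) auto
    qed
    then have "T \<subseteq> cball 0 ((B + norm x) / \<bar>e \<bullet> x\<bar>) \<times> {0..B}" by blast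
    then show ?thesis
      by (rule bounded_subset[rotated]) (intro bounded_Times bounded_cball bounded_closed_interval)
  qed
  ultimately have "compact T" by (simp add: compact_eq_bounded_closed)
  moreover have "(v0, B) \<in> T" using v0 B by (auto simp: T_def)
  ultimately obtain p where p: "p \<in> T" "\<And>q. q \<in> T \<Longrightarrow> snd p \<le> snd q"
    using continuous_attains_inf[of T snd] continuous_on_snd[OF continuous_on_id] by fastforce
  show thesis
  proof (rule that[of "fst p" "snd p"])
    fix w t
    assume w: "e \<bullet> w = 1" "\<And>z. z \<in> K \<Longrightarrow> norm (z - (e \<bullet> z) *\<^sub>R w) \<le> t"
    show "snd p \<le> t"
    proof (cases "t \<le> B")
      case True
      then have "(w, t) \<in> T" using w by (auto simp: T_def)
      then show ?thesis using p(2) by fastforce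
    next
      case False
      then show ?thesis using p(1) by (auto simp: T_def)
    qed
  qed (use p(1) in \<open>auto simp: T_def\<close>)
qed

text \<open>Up to the factor -2,
  \<open>(e \<bullet> z) *\<^sub>R (z - (e \<bullet> z) *\<^sub>R v)\<close> is the gradient in
  \<open>v\<close> of the squared length of the image of \<open>z\<close>. If 0 were outside the
  hull of the gradients at the contact points, a separating direction would shorten all the longest
  images at once, against optimality.\<close>

lemma optimal_oblique_projection_stationary:
  fixes K :: "'a::euclidean_space set"
  assumes "compact K" "K \<noteq> {}" and ev: "e \<bullet> v = 1"
    and le: "\<And>z. z \<in> K \<Longrightarrow> norm (z - (e \<bullet> z) *\<^sub>R v) \<le> \<rho>"
    and opt: "\<And>w t. e \<bullet> w = 1 \<Longrightarrow> (\<And>z. z \<in> K \<Longrightarrow> norm (z - (e \<bullet> z) *\<^sub>R w) \<le> t) \<Longrightarrow> \<rho> \<le> t"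
  shows "0 \<in> convex hull ((\<lambda>z. (e \<bullet> z) *\<^sub>R (z - (e \<bullet> z) *\<^sub>R v)) `
            {z \<in> K. norm (z - (e \<bullet> z) *\<^sub>R v) = \<rho>})" (is "0 \<in> convex hull ?G")
proof (rule ccontr)
  assume no: "0 \<notin> convex hull ?G"
  have "e \<noteq> 0" using ev by auto
  have "closed {z. norm (z - (e \<bullet> z) *\<^sub>R v) = \<rho>}"
    by (intro closed_Collect_eq continuous_intros)
  then have "compact {z \<in> K. norm (z - (e \<bullet> z) *\<^sub>R v) = \<rho>}"
    using compact_Int_closed[OF assms(1)] by (simp add: Collect_conj_eq)
  then have "compact ?G" by (intro compact_continuous_image continuous_intros)
  then have "closed (convex hull ?G)"
    using compact_convex_hull compact_imp_closed by blast
  from separating_hyperplane_closed_0[OF convex_convex_hull this no]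
  obtain d0 b where "0 < b" and sep: "\<forall>g\<in>convex hull ?G. b < d0 \<bullet> g" by blast
  have b: "b < d0 \<bullet> g" if "g \<in> ?G" for g
    by (rule bspec[OF sep], rule hull_inc, rule that)
  \<comment> \<open>Dropping the component along \<open>e\<close> keeps the normalisation
    \<open>e \<bullet> (v + t *\<^sub>R d) = 1\<close> and leaves inner products with projected
    points unchanged.\<close>
  define d where "d = d0 - ((e \<bullet> d0) / (e \<bullet> e)) *\<^sub>R e"
  have ed: "e \<bullet> d = 0" using \<open>e \<noteq> 0\<close> by (simp add: d_def inner_diff_right)
  have ep: "e \<bullet> (z - (e \<bullet> z) *\<^sub>R v) = 0" for z
    using ev by (simp add: inner_diff_right)
  have dpos: "0 < (e \<bullet> z) * (d \<bullet> (z - (e \<bullet> z) *\<^sub>R v))"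
    if "z \<in> K" "norm (z - (e \<bullet> z) *\<^sub>R v) = \<rho>" for z
  proof -
    have "0 < d0 \<bullet> ((e \<bullet> z) *\<^sub>R (z - (e \<bullet> z) *\<^sub>R v))"
      using b[of "(e \<bullet> z) *\<^sub>R (z - (e \<bullet> z) *\<^sub>R v)"] that \<open>0 < b\<close> by auto
    moreover have "d \<bullet> (z - (e \<bullet> z) *\<^sub>R v) = d0 \<bullet> (z - (e \<bullet> z) *\<^sub>R v)"
      using ep[of z] by (simp add: d_def inner_diff_left)
    ultimately show ?thesis by simp
  qed
  define \<epsilon> where "\<epsilon> n = inverse (real (Suc n))" for n
  have eps: "0 < \<epsilon> n" for n by (simp add: \<epsilon>_def)
  \<comment> \<open>\<open>opt\<close> is applied with \<open>t\<close> the largest image length for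
    the perturbed direction. These farthest points need not be contact points for \<open>v\<close>;
    only their limit \<open>l\<close> will be.\<close>
  have "\<exists>z\<in>K. \<rho> \<le> norm (z - (e \<bullet> z) *\<^sub>R (v + \<epsilon> n *\<^sub>R d))" for n
  proof -
    have "continuous_on K (\<lambda>z. norm (z - (e \<bullet> z) *\<^sub>R (v + \<epsilon> n *\<^sub>R d)))"
      by (intro continuous_intros)
    then obtain z where "z \<in> K" "\<And>y. y \<in> K \<Longrightarrow>
        norm (y - (e \<bullet> y) *\<^sub>R (v + \<epsilon> n *\<^sub>R d)) \<le> norm (z - (e \<bullet> z) *\<^sub>R (v + \<epsilon> n *\<^sub>R d))"
      using continuous_attains_sup[OF assms(1,2)] by blast
    then show ?thesis
      using opt[of "v + \<epsilon> n *\<^sub>R d"] ev ed by (auto simp: inner_add_right)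
  qed
  then obtain z where zK: "\<And>n. z n \<in> K"
    and z: "\<And>n. \<rho> \<le> norm (z n - (e \<bullet> z n) *\<^sub>R (v + \<epsilon> n *\<^sub>R d))" by metis
  obtain l r where "l \<in> K" "strict_mono r" and lim: "(z \<circ> r) \<longlonglongrightarrow> l"
    using assms(1) zK unfolding compact_def by metis
  have lim: "(\<lambda>n. z (r n)) \<longlonglongrightarrow> l" using lim by (simp add: o_def)
  have eps0: "(\<lambda>n. \<epsilon> (r n)) \<longlonglongrightarrow> 0"
    using LIMSEQ_subseq_LIMSEQ[OF LIMSEQ_inverse_real_of_nat \<open>strict_mono r\<close>]
    by (simp add: \<epsilon>_def o_def)
  have "0 \<le> \<rho>" using le[OF \<open>l \<in> K\<close>] norm_ge_zero order_trans by blast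
  \<comment> \<open>Expand the squared length after perturbation, bound the unperturbed one by
    \<open>\<rho>\<close>, and divide by \<open>\<epsilon> n\<close>.\<close>
  have first_order: "2 * ((e \<bullet> z n) * (d \<bullet> (z n - (e \<bullet> z n) *\<^sub>R v))) \<le> \<epsilon> n * ((e \<bullet> z n)\<^sup>2 * (d \<bullet> d))"
    for n
  proof -
    define p where "p = z n - (e \<bullet> z n) *\<^sub>R v"
    have "\<rho>\<^sup>2 \<le> (norm (p - (\<epsilon> n * (e \<bullet> z n)) *\<^sub>R d))\<^sup>2"
      using z[of n] \<open>0 \<le> \<rho>\<close> by (intro power_mono) (auto simp: p_def algebra_simps)
    also have "\<dots> = (norm p)\<^sup>2 - \<epsilon> n * (2 * ((e \<bullet> z n) * (d \<bullet> p)))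
                    + \<epsilon> n * (\<epsilon> n * ((e \<bullet> z n)\<^sup>2 * (d \<bullet> d)))"
      unfolding power2_norm_eq_inner
      by (simp add: inner_diff_left inner_diff_right inner_commute power2_eq_square algebra_simps)
    also have "(norm p)\<^sup>2 \<le> \<rho>\<^sup>2"
      using le[OF zK[of n]] by (auto simp: p_def intro: power_mono)
    finally have "\<epsilon> n * (2 * ((e \<bullet> z n) * (d \<bullet> p))) \<le> \<epsilon> n * (\<epsilon> n * ((e \<bullet> z n)\<^sup>2 * (d \<bullet> d)))"
      by simp
    then show ?thesis using eps[of n] unfolding p_def by (simp only: mult_le_cancel_left_pos)
  qed
  have "(\<lambda>n. 2 * ((e \<bullet> z (r n)) * (d \<bullet> (z (r n) - (e \<bullet> z (r n)) *\<^sub>R v))))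
      \<longlonglongrightarrow> 2 * ((e \<bullet> l) * (d \<bullet> (l - (e \<bullet> l) *\<^sub>R v)))"
    by (intro tendsto_intros lim)
  moreover have "(\<lambda>n. \<epsilon> (r n) * ((e \<bullet> z (r n))\<^sup>2 * (d \<bullet> d))) \<longlonglongrightarrow> 0 * ((e \<bullet> l)\<^sup>2 * (d \<bullet> d))"
    by (intro tendsto_intros lim eps0)
  ultimately have "2 * ((e \<bullet> l) * (d \<bullet> (l - (e \<bullet> l) *\<^sub>R v))) \<le> 0 * ((e \<bullet> l)\<^sup>2 * (d \<bullet> d))"
    by (rule LIMSEQ_le) (use first_order in blast)
  \<comment> \<open>The limit is a contact point, so \<open>dpos\<close> applies to it and
    contradicts the limit of the first-order inequality.\<close>
  moreover have "\<rho> \<le> norm (l - (e \<bullet> l) *\<^sub>R v)"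
  proof -
    have "(\<lambda>n. norm (z (r n) - (e \<bullet> z (r n)) *\<^sub>R (v + \<epsilon> (r n) *\<^sub>R d)))
        \<longlonglongrightarrow> norm (l - (e \<bullet> l) *\<^sub>R (v + 0 *\<^sub>R d))"
      by (intro tendsto_intros lim eps0)
    then have "\<rho> \<le> norm (l - (e \<bullet> l) *\<^sub>R (v + 0 *\<^sub>R d))"
      using z by (intro LIMSEQ_le_const) auto
    then show ?thesis by simp
  qed
  ultimately show False using dpos[OF \<open>l \<in> K\<close>] le[OF \<open>l \<in> K\<close>] by force
qed

text \<open>The slice bound keeps the projected contact points from being too opposite: their
  pairwise inner products are at least \<open>\<rho>\<^sup>2 - 2 * m\<^sup>2\<close>. By
  stationarity a positive combination of at most \<open>DIM('a)\<close> of them vanishes; expanding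
  its squared norm and applying Cauchy-Schwarz to the weights gives the constant.\<close>

lemma optimal_oblique_projection_bound:
  fixes K :: "'a::euclidean_space set" and \<rho> m :: real
  assumes "convex K" and sym: "uminus ` K = K" and ev: "e \<bullet> v = 1" and dim: "2 \<le> DIM('a)"
    and stationary: "0 \<in> convex hull ((\<lambda>z. (e \<bullet> z) *\<^sub>R (z - (e \<bullet> z) *\<^sub>R v)) `
            {z \<in> K. norm (z - (e \<bullet> z) *\<^sub>R v) = \<rho>})" (is "0 \<in> convex hull ?G")
    and slice: "\<And>y. y \<in> K \<Longrightarrow> e \<bullet> y = 0 \<Longrightarrow> norm y \<le> m"
  shows "DIM('a) * \<rho>\<^sup>2 \<le> 2 * (DIM('a) - 1) * m\<^sup>2"
\<comment> \<open>If \<open>\<rho>\<^sup>2 \<le> m\<^sup>2\<close>, the claim follows from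
  \<open>N \<le> 2 * (N - 1)\<close> for \<open>N \<ge> 2\<close>. The opposite case puts the
  contact points off the slice and fixes a sign in \<open>pair\<close>.\<close>
proof (cases "\<rho>\<^sup>2 \<le> m\<^sup>2")
  case True
  have "DIM('a) * \<rho>\<^sup>2 \<le> DIM('a) * m\<^sup>2" using True by (intro mult_left_mono) auto
  also have "\<dots> \<le> 2 * (DIM('a) - 1) * m\<^sup>2" using dim by (intro mult_right_mono) auto
  finally show ?thesis .
next
  case False
  have "e \<noteq> 0" using ev by auto
  define N where "N = DIM('a)"
  \<comment> \<open>The gradients lie in a hyperplane, so Caratheodory needs only \<open>N\<close>
    points instead of \<open>N + 1\<close>.\<close>
  have "?G \<subseteq> {g. e \<bullet> g = 0}" using ev by (auto simp: inner_diff_right)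
  then have "aff_dim ?G \<le> aff_dim {g. e \<bullet> g = 0}" by (rule aff_dim_subset)
  also have "\<dots> = int N - 1" using \<open>e \<noteq> 0\<close> by (simp add: N_def)
  finally have "aff_dim ?G + 1 \<le> int N" by simp
  then obtain S u where "finite S" "S \<subseteq> ?G" "card S \<le> N" and u: "\<And>g. g \<in> S \<Longrightarrow> 0 \<le> u g"
    "sum u S = 1" and u0: "(\<Sum>g\<in>S. u g *\<^sub>R g) = 0"
    using stationary unfolding convex_hull_caratheodory_aff_dim by fastforce
  \<comment> \<open>Passing from \<open>z\<close> to \<open>-z\<close> flips both factors of the
    gradient and leaves \<open>g\<close> unchanged, so heights may be taken positive.\<close>
  have "\<exists>z\<in>K. norm (z - (e \<bullet> z) *\<^sub>R v) = \<rho> \<and> (e \<bullet> z) *\<^sub>R (z - (e \<bullet> z) *\<^sub>R v) = g \<and> 0 < e \<bullet> z"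
    if gS: "g \<in> S" for g
  proof -
    obtain z where z: "z \<in> K" "norm (z - (e \<bullet> z) *\<^sub>R v) = \<rho>" "(e \<bullet> z) *\<^sub>R (z - (e \<bullet> z) *\<^sub>R v) = g"
      using subsetD[OF \<open>S \<subseteq> ?G\<close> gS] by auto
    have "e \<bullet> z \<noteq> 0"
    proof
      assume "e \<bullet> z = 0"
      then have "\<rho> \<le> m" "0 \<le> \<rho>" using slice z by auto
      then show False using False power_mono by blast
    qed
    moreover have "-z \<in> K" using z(1) sym by blast
    moreover have "norm (- z - (e \<bullet> - z) *\<^sub>R v) = \<rho>"
      using z(2) by (metis inner_minus_right minus_diff_eq minus_diff_minus norm_minus_cancel scaleR_minus_left)
    moreover have "(e \<bullet> - z) *\<^sub>R (- z - (e \<bullet> - z) *\<^sub>R v) = g"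
      using z(3) by (simp add: algebra_simps)
    ultimately show ?thesis using z
      by (cases "0 < e \<bullet> z") (blast, intro bexI[of _ "-z"], auto)
  qed
  then obtain \<zeta> where \<zeta>: "\<And>g. g \<in> S \<Longrightarrow> \<zeta> g \<in> K"
    "\<And>g. g \<in> S \<Longrightarrow> norm (\<zeta> g - (e \<bullet> \<zeta> g) *\<^sub>R v) = \<rho>"
    "\<And>g. g \<in> S \<Longrightarrow> (e \<bullet> \<zeta> g) *\<^sub>R (\<zeta> g - (e \<bullet> \<zeta> g) *\<^sub>R v) = g"
    "\<And>g. g \<in> S \<Longrightarrow> 0 < e \<bullet> \<zeta> g" by metis
  define h where "h g = e \<bullet> \<zeta> g" for g
  define p where "p g = \<zeta> g - h g *\<^sub>R v" for g
  define a where "a g = u g * h g" for g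
  have p_inner: "p g \<bullet> p g = \<rho>\<^sup>2" if "g \<in> S" for g
    using \<zeta>(2)[OF that] by (simp add: p_def h_def flip: power2_norm_eq_inner)
  have a_nonneg: "0 \<le> a g" if "g \<in> S" for g
    using u(1) \<zeta>(4) that by (simp add: a_def h_def less_imp_le)
  have asum: "(\<Sum>g\<in>S. a g *\<^sub>R p g) = 0"
  proof -
    have "(\<Sum>g\<in>S. a g *\<^sub>R p g) = (\<Sum>g\<in>S. u g *\<^sub>R g)"
      using \<zeta>(3) by (intro sum.cong) (auto simp: a_def p_def h_def simp flip: scaleR_scaleR)
    then show ?thesis using u0 by simp
  qed
  have apos: "0 < sum a S"
  proof -
    have "\<exists>g\<in>S. 0 < u g"
      using u by (metis less_eq_real_def sum.neutral zero_neq_one)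
    then obtain g where "g \<in> S" "0 < a g"
      using \<zeta>(4) by (auto simp: a_def h_def)
    then show ?thesis using \<open>finite S\<close> a_nonneg by (meson sum_pos2)
  qed
  have pair: "\<rho>\<^sup>2 - 2 * m\<^sup>2 \<le> p f \<bullet> p g" if "f \<in> S" "g \<in> S" for f g
  proof -
    have h: "0 < h f" "0 < h g" using \<zeta>(4) that by (auto simp: h_def)
    \<comment> \<open>The point at height zero on the segment from \<open>\<zeta> f\<close> to
      \<open>- \<zeta> g\<close>, found by weighting each end with the height of the other.\<close>
    define y where "y = (h g / (h f + h g)) *\<^sub>R \<zeta> f + (h f / (h f + h g)) *\<^sub>R (- \<zeta> g)"
    have "- \<zeta> g \<in> K" using \<zeta>(1)[OF that(2)] sym by blast
    then have "y \<in> K"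
      unfolding y_def using \<zeta>(1) that h
      by (intro convexD[OF \<open>convex K\<close>]) (auto simp flip: add_divide_distrib)
    have sy: "(h f + h g) *\<^sub>R y = h g *\<^sub>R p f - h f *\<^sub>R p g"
    proof -
      have "(h f + h g) *\<^sub>R y = h g *\<^sub>R \<zeta> f - h f *\<^sub>R \<zeta> g"
        using h by (simp add: y_def scaleR_diff_right)
      then show ?thesis by (simp add: p_def scaleR_diff_right mult.commute)
    qed
    have "e \<bullet> y = 0"
      unfolding y_def inner_add_right inner_scaleR_right inner_minus_right by (simp add: h_def)
    then have "norm y \<le> m" using slice \<open>y \<in> K\<close> by blast
    then have "(norm y)\<^sup>2 \<le> m\<^sup>2" by (intro power_mono) auto
    then have "(h f + h g)\<^sup>2 * (norm y)\<^sup>2 \<le> (h f + h g)\<^sup>2 * m\<^sup>2" by (intro mult_left_mono) auto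
    moreover have "(h f + h g)\<^sup>2 * (norm y)\<^sup>2 = (norm (h g *\<^sub>R p f - h f *\<^sub>R p g))\<^sup>2"
      unfolding sy[symmetric] by (simp add: power_mult_distrib)
    moreover have "\<dots> = ((h g)\<^sup>2 + (h f)\<^sup>2) * \<rho>\<^sup>2 - 2 * (h f * h g) * (p f \<bullet> p g)"
      unfolding power2_norm_eq_inner using p_inner that
      by (simp add: inner_diff_left inner_diff_right inner_commute power2_eq_square algebra_simps)
    ultimately have "((h g)\<^sup>2 + (h f)\<^sup>2) * \<rho>\<^sup>2 - (h f + h g)\<^sup>2 * m\<^sup>2 \<le> 2 * (h f * h g) * (p f \<bullet> p g)"
      by linarith
    \<comment> \<open>This splitting isolates the wanted bound; the remainder vanishes for equal
      heights and is otherwise nonnegative because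
      \<open>\<rho>\<^sup>2 > m\<^sup>2\<close>.\<close>
    moreover have "((h g)\<^sup>2 + (h f)\<^sup>2) * \<rho>\<^sup>2 - (h f + h g)\<^sup>2 * m\<^sup>2 =
        2 * (h f * h g) * (\<rho>\<^sup>2 - 2 * m\<^sup>2) + (h f - h g)\<^sup>2 * (\<rho>\<^sup>2 - m\<^sup>2)"
      by (simp add: power2_eq_square algebra_simps)
    moreover have "0 \<le> (h f - h g)\<^sup>2 * (\<rho>\<^sup>2 - m\<^sup>2)" using False by simp
    ultimately have "2 * (h f * h g) * (\<rho>\<^sup>2 - 2 * m\<^sup>2) \<le> 2 * (h f * h g) * (p f \<bullet> p g)" by linarith
    then show ?thesis using h by (simp only: mult_le_cancel_left_pos mult_pos_pos zero_less_numeral)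
  qed
  \<comment> \<open>Off the diagonal \<open>pair\<close> is used; on it the inner product is exactly
    \<open>\<rho>\<^sup>2\<close>, which accounts for the extra
    \<open>2 * m\<^sup>2\<close>.\<close>
  have "(\<rho>\<^sup>2 - 2 * m\<^sup>2) * (sum a S)\<^sup>2 + 2 * m\<^sup>2 * (\<Sum>g\<in>S. (a g)\<^sup>2)
      = (\<Sum>f\<in>S. \<Sum>g\<in>S. a f * a g * (\<rho>\<^sup>2 - 2 * m\<^sup>2 + (if f = g then 2 * m\<^sup>2 else 0)))"
    using \<open>finite S\<close>
    by (simp add: distrib_left sum.distrib power2_eq_square sum_product sum_distrib_left sum_distrib_right
        if_distrib[of "\<lambda>t. _ * t"] mult_ac cong: if_cong)
  also have "\<dots> \<le> (\<Sum>f\<in>S. \<Sum>g\<in>S. a f * a g * (p f \<bullet> p g))"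
    using pair p_inner a_nonneg by (intro sum_mono mult_left_mono) auto
  also have "\<dots> = (\<Sum>f\<in>S. a f *\<^sub>R p f) \<bullet> (\<Sum>g\<in>S. a g *\<^sub>R p g)"
    by (simp add: inner_sum_left inner_sum_right sum_distrib_left mult_ac inner_commute)
  finally have key: "(\<rho>\<^sup>2 - 2 * m\<^sup>2) * (sum a S)\<^sup>2 + 2 * m\<^sup>2 * (\<Sum>g\<in>S. (a g)\<^sup>2) \<le> 0"
    by (simp add: asum)
  have "(sum a S)\<^sup>2 \<le> (\<Sum>g\<in>S. (a g)\<^sup>2) * card S" by (rule sum_squared_le_sum_of_squares)
  also have "\<dots> \<le> (\<Sum>g\<in>S. (a g)\<^sup>2) * N"
    using \<open>card S \<le> N\<close> by (intro mult_left_mono sum_nonneg) auto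
  finally have "2 * m\<^sup>2 * (sum a S)\<^sup>2 \<le> 2 * m\<^sup>2 * ((\<Sum>g\<in>S. (a g)\<^sup>2) * N)"
    by (intro mult_left_mono) auto
  moreover have "N * ((\<rho>\<^sup>2 - 2 * m\<^sup>2) * (sum a S)\<^sup>2 + 2 * m\<^sup>2 * (\<Sum>g\<in>S. (a g)\<^sup>2)) \<le> 0"
    using key by (simp add: mult_nonneg_nonpos)
  ultimately have "(N * \<rho>\<^sup>2 - 2 * (real N - 1) * m\<^sup>2) * (sum a S)\<^sup>2 \<le> 0"
    by (simp add: algebra_simps)
  then have "N * \<rho>\<^sup>2 - 2 * (real N - 1) * m\<^sup>2 \<le> 0"
    using apos by (simp add: mult_le_0_iff)
  \<comment> \<open>The subtraction in the goal is on natural numbers; \<open>dim\<close> makes it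
    agree with the real one.\<close>
  then show ?thesis using dim by (simp add: N_def of_nat_diff)
qed

section \<open>Orthogonal projections and upper bounds for the outer radius\<close>

lemma oproj_eqI:
  assumes "subspace L" "p \<in> L" "\<And>y. y \<in> L \<Longrightarrow> orthogonal (x - p) y"
  shows "oproj L x = p"
  unfolding oproj_def
proof (rule the_equality)
  fix q
  assume q: "q \<in> L \<and> (\<forall>y\<in>L. orthogonal (x - q) y)"
  have "q - p \<in> L" using assms q by (simp add: subspace_diff)
  then have "orthogonal (x - p) (q - p)" "orthogonal (x - q) (q - p)" using assms q by auto
  then have "(q - p) \<bullet> (q - p) = 0"
    by (simp add: orthogonal_def inner_diff_left inner_diff_right inner_commute)
  then show "q = p" by simp
qed (use assms in auto)

lemma circumradius_in_nonneg:
  assumes "bounded C" "C \<noteq> {}" "A \<noteq> {}"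
  shows "0 \<le> circumradius_in C A"
  unfolding circumradius_in_def
proof (rule cInf_greatest)
  obtain c where "c \<in> A" using assms by blast
  moreover obtain r where "C \<subseteq> cball c r"
    using bounded_any_center[of C c] assms(1) by (auto simp: dist_commute subset_iff)
  ultimately show "{r. \<exists>c\<in>A. C \<subseteq> cball c r} \<noteq> {}" by blast
  fix r
  assume "r \<in> {r. \<exists>c\<in>A. C \<subseteq> cball c r}"
  then obtain c where "C \<subseteq> cball c r" by blast
  then have "cball c r \<noteq> {}" using assms(2) by blast
  then show "0 \<le> r" by simp
qed

lemma circumradius_in_le:
  assumes "C \<noteq> {}" "c \<in> A" "C \<subseteq> cball c r"
  shows "circumradius_in C A \<le> r"
  unfolding circumradius_in_def
proof (rule cInf_lower)
  have "0 \<le> t" if "C \<subseteq> cball c t" for c t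
    using that assms(1) by (metis cball_eq_empty not_less subset_empty)
  then show "bdd_below {r. \<exists>c\<in>A. C \<subseteq> cball c r}" by (intro bdd_belowI[of _ 0]) auto
qed (use assms in auto)

text \<open>Projection does not lengthen vectors. Boundedness of the image makes each circumradius
  the infimum of a nonempty set, hence nonnegative, so that the infimum over all subspaces is
  meaningful.\<close>

lemma bounded_oproj_image:
  fixes K :: "'a::euclidean_space set"
  assumes "bounded K" "subspace L"
  shows "bounded (oproj L ` K)"
proof -
  obtain B where B: "\<And>z. z \<in> K \<Longrightarrow> norm z \<le> B" using assms(1) bounded_iff by blast
  have "norm (oproj L z) \<le> norm z" for z
  proof -
    obtain y w where yw: "y \<in> span L" "\<And>t. t \<in> span L \<Longrightarrow> orthogonal w t" "z = y + w"
      using orthogonal_subspace_decomp_exists[of L z] by metis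
    have L: "span L = L" using assms(2) by (simp add: span_eq_iff)
    have "oproj L z = y" using yw L assms(2) by (intro oproj_eqI) auto
    moreover have "(norm z)\<^sup>2 = (norm y)\<^sup>2 + (norm w)\<^sup>2"
      using yw(2)[OF yw(1)] yw(3) by (simp add: norm_add_Pythagorean orthogonal_commute)
    ultimately show ?thesis by (metis le_add_same_cancel1 norm_ge_zero power2_le_imp_le zero_le_power2)
  qed
  then show ?thesis using B by (intro boundedI[of _ B]) (auto intro: order_trans)
qed

lemma outer_radius_le_circumradius:
  fixes K :: "'a::euclidean_space set"
  assumes "bounded K" "K \<noteq> {}" "L \<in> lin_subspaces i"
  shows "outer_radius i K \<le> circumradius_in (oproj L ` K) L"
  unfolding outer_radius_def
proof (rule cInf_lower)
  have "0 \<le> circumradius_in (oproj M ` K) M" if "M \<in> lin_subspaces i" for M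
    using that assms bounded_oproj_image
    by (intro circumradius_in_nonneg) (auto simp: lin_subspaces_def dest: subspace_0)
  then show "bdd_below {circumradius_in (oproj L ` K) L |L. L \<in> lin_subspaces i}"
    by (intro bdd_belowI[of _ 0]) auto
qed (use assms in auto)

text \<open>Among all points \<open>z - c z *\<^sub>R v\<close> of the line through \<open>z\<close>
  along \<open>v\<close>, the orthogonal projection onto the complement of \<open>v\<close> is
  nearest the origin, by Pythagoras. Hence any oblique projection along \<open>v\<close> bounds the
  orthogonal one.\<close>

lemma outer_radius_le_oblique:
  fixes K :: "'a::euclidean_space set"
  assumes "bounded K" "K \<noteq> {}" "v \<noteq> 0" and le: "\<And>z. z \<in> K \<Longrightarrow> norm (z - c z *\<^sub>R v) \<le> \<rho>"
  shows "outer_radius (DIM('a) - 1) K \<le> \<rho>"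
proof -
  define L where "L = {y. v \<bullet> y = 0}"
  have L: "subspace L" "dim L = DIM('a) - 1"
    using assms by (auto simp: L_def subspace_hyperplane dim_hyperplane)
  have "norm (oproj L z) \<le> \<rho>" if "z \<in> K" for z
  proof -
    define q where "q = z - ((v \<bullet> z) / (v \<bullet> v)) *\<^sub>R v"
    have "q \<in> L" using assms by (simp add: L_def q_def inner_diff_right)
    then have "oproj L z = q"
      using L(1) by (intro oproj_eqI) (auto simp: q_def L_def orthogonal_def)
    moreover have "(norm (z - c z *\<^sub>R v))\<^sup>2 = (norm q)\<^sup>2 + (norm (((v \<bullet> z) / (v \<bullet> v) - c z) *\<^sub>R v))\<^sup>2"
    proof -
      have "orthogonal q (((v \<bullet> z) / (v \<bullet> v) - c z) *\<^sub>R v)"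
        using \<open>q \<in> L\<close> by (simp add: L_def orthogonal_def inner_commute)
      moreover have "z - c z *\<^sub>R v = q + ((v \<bullet> z) / (v \<bullet> v) - c z) *\<^sub>R v"
        by (simp add: q_def algebra_simps)
      ultimately show ?thesis by (simp only: norm_add_Pythagorean)
    qed
    ultimately have "norm (oproj L z) \<le> norm (z - c z *\<^sub>R v)"
      by (metis le_add_same_cancel1 norm_ge_zero power2_le_imp_le zero_le_power2)
    then show ?thesis using le[OF that] by linarith
  qed
  then have "circumradius_in (oproj L ` K) L \<le> \<rho>"
    using assms L(1) by (intro circumradius_in_le[of _ 0]) (auto dest: subspace_0)
  moreover have "outer_radius (DIM('a) - 1) K \<le> circumradius_in (oproj L ` K) L"
    using assms L by (intro outer_radius_le_circumradius) (auto simp: lin_subspaces_def)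
  ultimately show ?thesis by linarith
qed

section \<open>Bounds for the inner radius\<close>

text \<open>The disc has a diameter of length \<open>2 * r\<close> because \<open>L\<close> has
  positive dimension, and both endpoints have norm at most \<open>B\<close>. This supplies the upper
  bounds needed for the suprema defining the inner radius.\<close>

lemma disc_radius_le:
  fixes K :: "'a::euclidean_space set"
  assumes K: "\<And>z. z \<in> K \<Longrightarrow> norm z \<le> B" and "subspace L" "0 < dim L" "0 \<le> r"
    and "c \<in> (+) x ` L" and sub: "cball c r \<inter> (+) x ` L \<subseteq> K"
  shows "r \<le> B"
proof -
  have "\<not> L \<subseteq> {0}" using assms(3) by (metis dim_eq_0 less_irrefl)
  then obtain y where "y \<in> L" "y \<noteq> 0" by blast
  define w where "w = (r / norm y) *\<^sub>R y"
  have w: "w \<in> L" "norm w = r" using \<open>y \<in> L\<close> \<open>y \<noteq> 0\<close> assms by (auto simp: w_def subspace_scale)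
  obtain l where l: "l \<in> L" "c = x + l" using assms by blast
  have "c + w = x + (l + w)" "c - w = x + (l - w)" using l by auto
  then have "c + w \<in> (+) x ` L" "c - w \<in> (+) x ` L"
    using l w assms(2) subspace_add subspace_diff by blast+
  moreover have "c + w \<in> cball c r" "c - w \<in> cball c r" using w by (auto simp: dist_norm)
  ultimately have "norm (c + w) \<le> B" "norm (c - w) \<le> B" using K sub by blast+
  moreover have "2 * r \<le> norm (c + w) + norm (c - w)"
  proof -
    have "norm (2 *\<^sub>R w) = norm ((c + w) - (c - w))" by (simp add: scaleR_2)
    also have "\<dots> \<le> norm (c + w) + norm (c - w)" by (rule norm_triangle_ineq4)
    finally show ?thesis using w by simp
  qed
  ultimately show ?thesis by linarith
qed

lemma inradius_section_le:
  fixes K :: "'a::euclidean_space set"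
  assumes "\<And>z. z \<in> K \<Longrightarrow> norm z \<le> B" "subspace L" "0 < dim L" "K \<inter> (+) x ` L \<noteq> {}"
  shows "inradius_in (K \<inter> (+) x ` L) ((+) x ` L) \<le> B"
  unfolding inradius_in_def
proof (rule cSup_least)
  obtain c where "c \<in> K \<inter> (+) x ` L" using assms by blast
  then have "0 \<in> {r. 0 \<le> r \<and> (\<exists>c\<in>(+) x ` L. cball c r \<inter> (+) x ` L \<subseteq> K \<inter> (+) x ` L)}" by auto
  then show "{r. 0 \<le> r \<and> (\<exists>c\<in>(+) x ` L. cball c r \<inter> (+) x ` L \<subseteq> K \<inter> (+) x ` L)} \<noteq> {}" by blast
  fix r
  assume "r \<in> {r. 0 \<le> r \<and> (\<exists>c\<in>(+) x ` L. cball c r \<inter> (+) x ` L \<subseteq> K \<inter> (+) x ` L)}"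
  then show "r \<le> B" using disc_radius_le[OF assms(1-3)] by blast
qed

lemma inner_radius_le:
  fixes K :: "'a::euclidean_space set"
  assumes B: "\<And>z. z \<in> K \<Longrightarrow> norm z \<le> B" and "0 < i" "i \<le> DIM('a)" "K \<noteq> {}"
  shows "inner_radius i K \<le> B"
  unfolding inner_radius_def
proof (rule cSup_least)
  obtain L :: "'a set" where L: "subspace L" "dim L = i"
    using choose_subspace_of_subspace[of i "UNIV :: 'a set"] assms by auto
  \<comment> \<open>Splitting a point of \<open>K\<close> along \<open>L\<close> produces an
    admissible translate meeting \<open>K\<close>, so the supremum is over a nonempty
    family.\<close>
  obtain z where "z \<in> K" using assms by blast
  obtain y w where yw: "y \<in> span L" "\<And>t. t \<in> span L \<Longrightarrow> orthogonal w t" "z = y + w"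
    using orthogonal_subspace_decomp_exists[of L z] by metis
  have "span L = L" using L by (simp add: span_eq_iff)
  have "y \<in> L" using yw(1) unfolding \<open>span L = L\<close> .
  have "w \<in> orthogonal_comp L"
    using yw(2)[OF span_base] by (auto simp: orthogonal_comp_def orthogonal_commute)
  moreover have "z \<in> (+) w ` L" using yw(3) \<open>y \<in> L\<close> by (simp add: add.commute[of y])
  ultimately show "{inradius_in (K \<inter> (+) x ` L) ((+) x ` L) |L x. L \<in> lin_subspaces i \<and>
      x \<in> orthogonal_comp L \<and> K \<inter> (+) x ` L \<noteq> {}} \<noteq> {}"
    using L \<open>z \<in> K\<close> unfolding lin_subspaces_def by blast
  fix r
  assume "r \<in> {inradius_in (K \<inter> (+) x ` L) ((+) x ` L) |L x. L \<in> lin_subspaces i \<and>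
      x \<in> orthogonal_comp L \<and> K \<inter> (+) x ` L \<noteq> {}}"
  then obtain M x where M: "subspace M" "dim M = i" "K \<inter> (+) x ` M \<noteq> {}"
    and r: "r = inradius_in (K \<inter> (+) x ` M) ((+) x ` M)"
    unfolding lin_subspaces_def by blast
  show "r \<le> B" unfolding r using M assms(2) by (intro inradius_section_le B) auto
qed

lemma inner_radius_ge:
  fixes K :: "'a::euclidean_space set"
  assumes "bounded K" "0 < i" "subspace L" "dim L = i" "0 \<le> r" "cball 0 r \<inter> L \<subseteq> K"
  shows "r \<le> inner_radius i K"
proof -
  obtain B where B: "\<And>z. z \<in> K \<Longrightarrow> norm z \<le> B" using assms(1) bounded_iff by blast
  have "0 \<in> L" using assms by (simp add: subspace_0)
  have "r \<le> inradius_in (K \<inter> (+) 0 ` L) ((+) 0 ` L)"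
    unfolding inradius_in_def
  proof (rule cSup_upper)
    show "bdd_above {r. 0 \<le> r \<and> (\<exists>c\<in>(+) 0 ` L. cball c r \<inter> (+) 0 ` L \<subseteq> K \<inter> (+) 0 ` L)}"
      using disc_radius_le[OF B assms(3)] assms by (intro bdd_aboveI[of _ B]) blast
  qed (use assms \<open>0 \<in> L\<close> in auto)
  also have "\<dots> \<le> inner_radius i K"
    unfolding inner_radius_def
  proof (rule cSup_upper)
    have "0 \<in> K" using assms \<open>0 \<in> L\<close> by auto
    then show "inradius_in (K \<inter> (+) 0 ` L) ((+) 0 ` L) \<in> {inradius_in (K \<inter> (+) x ` L) ((+) x ` L) |L x.
        L \<in> lin_subspaces i \<and> x \<in> orthogonal_comp L \<and> K \<inter> (+) x ` L \<noteq> {}}"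
      using assms \<open>0 \<in> L\<close> unfolding mem_Collect_eq
      by (intro exI[of _ L] exI[of _ "0 :: 'a"])
        (auto simp: lin_subspaces_def orthogonal_comp_def orthogonal_def)
    show "bdd_above {inradius_in (K \<inter> (+) x ` L) ((+) x ` L) |L x.
        L \<in> lin_subspaces i \<and> x \<in> orthogonal_comp L \<and> K \<inter> (+) x ` L \<noteq> {}}"
      using inradius_section_le[of K B] B assms(2)
      by (intro bdd_aboveI[of _ B]) (auto simp: lin_subspaces_def)
  qed
  finally show ?thesis .
qed

text \<open>For \<open>y = s *\<^sub>R x + t *\<^sub>R a\<close> in the disc, orthogonality and
  \<open>norm a \<le> norm x\<close> give \<open>s\<^sup>2 + t\<^sup>2 \<le> 1/2\<close>, hence
  \<open>\<bar>s\<bar> + \<bar>t\<bar> \<le> 1\<close>, so \<open>y\<close> lies in the rhombus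
  spanned by \<open>x\<close>, \<open>a\<close> and their negatives.\<close>

lemma inner_radius_2_ge_rhombus:
  fixes K :: "'a::euclidean_space set"
  assumes "bounded K" "convex K" and sym: "uminus ` K = K" and "x \<in> K" "a \<in> K" "a \<noteq> 0"
    and "x \<bullet> a = 0" "norm a \<le> norm x"
  shows "norm a / sqrt 2 \<le> inner_radius 2 K"
proof (rule inner_radius_ge[where L = "span {x, a}"])
  have "x \<noteq> 0" using assms by auto
  have "x \<noteq> a" using assms by auto
  then have "independent {x, a}"
    using assms \<open>x \<noteq> 0\<close>
    by (intro pairwise_orthogonal_independent) (auto simp: pairwise_def orthogonal_def inner_commute)
  then show "dim (span {x, a}) = 2" using \<open>x \<noteq> a\<close> using dim_span_eq_card_independent by fastforce
  show "cball 0 (norm a / sqrt 2) \<inter> span {x, a} \<subseteq> K"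
  proof
    fix y
    assume y: "y \<in> cball 0 (norm a / sqrt 2) \<inter> span {x, a}"
    then obtain s t where st: "y = s *\<^sub>R x + t *\<^sub>R a"
      by (auto simp: span_insert span_singleton algebra_simps)
    have "(norm y)\<^sup>2 \<le> (norm a / sqrt 2)\<^sup>2" using y by (intro power_mono) auto
    moreover have "(norm y)\<^sup>2 = s\<^sup>2 * (norm x)\<^sup>2 + t\<^sup>2 * (norm a)\<^sup>2"
      unfolding st using assms(7)
      by (subst norm_add_Pythagorean) (auto simp: orthogonal_def power_mult_distrib)
    moreover have "s\<^sup>2 * (norm a)\<^sup>2 \<le> s\<^sup>2 * (norm x)\<^sup>2"
      using assms by (intro mult_left_mono power_mono) auto
    ultimately have "(s\<^sup>2 + t\<^sup>2) * (norm a)\<^sup>2 \<le> (1/2) * (norm a)\<^sup>2"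
      by (simp add: power_divide algebra_simps)
    then have "s\<^sup>2 + t\<^sup>2 \<le> 1/2" using \<open>a \<noteq> 0\<close> by (subst (asm) mult_le_cancel_right_pos) auto
    moreover have "(\<bar>s\<bar> + \<bar>t\<bar>)\<^sup>2 \<le> 2 * (s\<^sup>2 + t\<^sup>2)"
      using zero_le_power2[of "\<bar>s\<bar> - \<bar>t\<bar>"] by (simp add: power2_sum power2_diff)
    ultimately have "(\<bar>s\<bar> + \<bar>t\<bar>)\<^sup>2 \<le> 1\<^sup>2" by simp
    then have le1: "\<bar>s\<bar> + \<bar>t\<bar> \<le> 1" by (rule power2_le_imp_le) simp
    \<comment> \<open>The signs select the quarter of the rhombus that contains
      \<open>y\<close>.\<close>
    define x' where "x' = (if 0 \<le> s then x else - x)"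
    define a' where "a' = (if 0 \<le> t then a else - a)"
    have neg: "- z \<in> K" if "z \<in> K" for z using that sym by blast
    have "x' \<in> K" "a' \<in> K" using assms neg by (auto simp: x'_def a'_def)
    moreover have "0 \<in> K"
      using convexD[OF \<open>convex K\<close> \<open>a \<in> K\<close> neg[OF \<open>a \<in> K\<close>], of "1/2" "1/2"] by simp
    ultimately have "convex hull {x', a', 0} \<subseteq> K"
      using \<open>convex K\<close> by (intro hull_minimal) auto
    moreover have "\<bar>s\<bar> *\<^sub>R x' + \<bar>t\<bar> *\<^sub>R a' + (1 - \<bar>s\<bar> - \<bar>t\<bar>) *\<^sub>R 0 \<in> convex hull {x', a', 0}"
      unfolding convex_hull_3 mem_Collect_eq using le1
      by (intro exI[of _ "\<bar>s\<bar>"] exI[of _ "\<bar>t\<bar>"] exI[of _ "1 - \<bar>s\<bar> - \<bar>t\<bar>"]) simp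
    moreover have "y = \<bar>s\<bar> *\<^sub>R x' + \<bar>t\<bar> *\<^sub>R a'"
      by (simp add: st x'_def a'_def)
    ultimately show "y \<in> K" by (simp add: subset_iff)
  qed
qed (use assms in auto)

text \<open>For the empty set both radii are junk values: \<open>Sup {}\<close> and \<open>Sup UNIV\<close> are the same
  unspecified real number, which makes the two radii opposite.\<close>

lemma outer_radius_empty:
  assumes "i \<le> DIM('a::euclidean_space)"
  shows "outer_radius i ({} :: 'a set) = - inner_radius i ({} :: 'a set)"
proof -
  \<comment> \<open>No real bounds \<open>UNIV\<close> above, and the upper bounds of the empty set
    have no least element. Both \<open>LEAST\<close> descriptions therefore reduce to the same
    unsatisfiable predicate under \<open>The\<close>.\<close>
  have "Sup (UNIV :: real set) = Sup {}"
    unfolding Sup_real_def Least_def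
    by (rule arg_cong[where f = The], rule ext) (metis UNIV_I empty_iff gt_ex lt_ex not_le)
  then have "Inf (UNIV :: real set) = - Sup {}"
    unfolding Inf_real_def by (simp add: surj_uminus)
  moreover have "circumradius_in {} L = Inf UNIV" if "L \<in> lin_subspaces i" for L :: "'a set"
    using that subspace_0 by (auto simp: circumradius_in_def lin_subspaces_def intro!: arg_cong[where f = Inf])
  moreover obtain L :: "'a set" where "L \<in> lin_subspaces i"
    using choose_subspace_of_subspace[of i "UNIV :: 'a set"] assms by (auto simp: lin_subspaces_def)
  ultimately have "{circumradius_in (oproj L ` {}) L | L. L \<in> (lin_subspaces i :: 'a set set)} = {- Sup {}}"
    by (auto intro!: exI[of _ L])
  then show ?thesis unfolding outer_radius_def inner_radius_def by simp
qed

theorem theorem1p1: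
  fixes K :: "(real^3) set"
  assumes "compact K" and "convex K" and "uminus ` K = K"
    and "inner_radius 2 K > 0"
  shows "outer_radius 2 K / inner_radius 2 K \<le> 2 * sqrt 2 / sqrt 3"
\<comment> \<open>The hypotheses do not exclude the empty set; there the quotient is -1.\<close>
proof (cases "K = {}")
  case True
  then have "outer_radius 2 K = - inner_radius 2 K" using outer_radius_empty[where 'a = "real^3", of 2] by simp
  then have "outer_radius 2 K / inner_radius 2 K = - 1" using assms(4) by simp
  also have "\<dots> \<le> 2 * sqrt 2 / sqrt 3" by (rule order_trans[of _ 0]) auto
  finally show ?thesis .
next
  case False
  note bK = compact_imp_bounded[OF assms(1)]
  obtain x where x: "x \<in> K" "\<And>z. z \<in> K \<Longrightarrow> norm z \<le> norm x"
    using continuous_attains_sup[OF assms(1) False continuous_on_norm_id] by blast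
  \<comment> \<open>If the farthest point were 0, \<open>inner_radius_le\<close> would force the
    inner radius to be at most 0.\<close>
  have "0 < norm x" using inner_radius_le[of K "norm x" 2] x False assms(4) by fastforce
  then obtain v \<rho> where v: "x \<bullet> v = 1" "\<And>z. z \<in> K \<Longrightarrow> norm (z - (x \<bullet> z) *\<^sub>R v) \<le> \<rho>"
    "\<And>w t. x \<bullet> w = 1 \<Longrightarrow> (\<And>z. z \<in> K \<Longrightarrow> norm (z - (x \<bullet> z) *\<^sub>R w) \<le> t) \<Longrightarrow> \<rho> \<le> t"
    using exists_optimal_oblique_projection[OF assms(1) x(1), of x] by auto
  have "compact (K \<inter> {z. x \<bullet> z = 0})" by (intro compact_Int_closed assms closed_hyperplane)
  moreover have "0 \<in> K \<inter> {z. x \<bullet> z = 0}"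
  proof -
    have "- x \<in> K" using x(1) assms(3) by blast
    then show ?thesis using convexD[OF assms(2) x(1), of "-x" "1/2" "1/2"] by simp
  qed
  ultimately obtain a where a: "a \<in> K" "x \<bullet> a = 0" "\<And>z. z \<in> K \<Longrightarrow> x \<bullet> z = 0 \<Longrightarrow> norm z \<le> norm a"
    using continuous_attains_sup[OF _ _ continuous_on_norm_id, of "K \<inter> {z. x \<bullet> z = 0}"] by blast
  have "v \<noteq> 0" using v(1) by auto
  then have R: "outer_radius 2 K \<le> \<rho>"
    using outer_radius_le_oblique[OF bK False _ v(2)] by simp
  have stationary: "0 \<in> convex hull ((\<lambda>z. (x \<bullet> z) *\<^sub>R (z - (x \<bullet> z) *\<^sub>R v)) `
      {z \<in> K. norm (z - (x \<bullet> z) *\<^sub>R v) = \<rho>})"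
    by (rule optimal_oblique_projection_stationary[OF assms(1) False v(1)]) (use v in auto)
  \<comment> \<open>The normal is \<open>x\<close> itself and \<open>m\<close> is the length of the
    longest vector \<open>a\<close> of the central slice; dimension 3 gives the factors 3 and
    4.\<close>
  have "real DIM(real^3) * \<rho>\<^sup>2 \<le> real (2 * (DIM(real^3) - 1)) * (norm a)\<^sup>2"
    by (rule optimal_oblique_projection_bound[OF assms(2,3) v(1) _ stationary a(3)]) auto
  then have "3 * \<rho>\<^sup>2 \<le> 4 * (norm a)\<^sup>2" by simp
  then have "(sqrt 3 * \<rho>)\<^sup>2 \<le> (2 * norm a)\<^sup>2" by (simp add: power_mult_distrib)
  then have "sqrt 3 * \<rho> \<le> 2 * norm a" by (rule power2_le_imp_le) simp
  moreover have "norm a \<le> sqrt 2 * inner_radius 2 K"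
  \<comment> \<open>The rhombus degenerates for \<open>a = 0\<close>, where positivity of the inner
    radius suffices.\<close>
  proof (cases "a = 0")
    case False
    then show ?thesis
      using inner_radius_2_ge_rhombus[OF bK assms(2,3) x(1) a(1) _ a(2)] x(2)[OF a(1)]
      by (simp add: field_simps)
  qed (use assms(4) in simp)
  ultimately have "sqrt 3 * \<rho> \<le> 2 * sqrt 2 * inner_radius 2 K" by simp
  moreover have "sqrt 3 * outer_radius 2 K \<le> sqrt 3 * \<rho>" using R by simp
  ultimately have "sqrt 3 * outer_radius 2 K \<le> 2 * sqrt 2 * inner_radius 2 K" by linarith
  then show ?thesis using assms(4) by (simp add: field_simps)
qed

end
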